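(* If $G$ is the incidence graph of a symmetric $\mathrm{BIBD}(v,b,r,k,1)$ (so $v = b$ and $r = k$), then $\zeta(G) > k-1$.
   Context: A $\mathrm{BIBD}(v,b,r,k,\lambda)$ is a set $X$ of $v$ points together with a collection $\mathcal{B}$ of $b$ blocks (subsets of $X$) such that every block has size $k$, every point lies in exactly $r$ blocks, and every pair of distinct points lies in exactly $\lambda$ blocks; it is symmetric if $v=b$. Its incidence graph is the bipartite graph on $X \cup \mathcal{B}$ with $x \sim B$ iff $x \in B$. Localization game on a connected graph $G$ with $k$ cops: the robber chooses a starting vertex, invisible to the cops. Each round the cops choose any $k$ vertices (no adjacency restriction) and each learns its distance to the robber; the cops win if after finitely many rounds they determine the robber's vertex uniquely; otherwise the robber moves to a neighbour or stays. The robber knows the cops' strategy. $\zeta(G)$ is the least $k$ for which $k$ cops can guarantee capture. *)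

theory Defs
  imports Complex_Main "HOL-Library.Extended_Nat"
begin

definition bibd ::
  "'a set \<Rightarrow> 'a set set \<Rightarrow> nat \<Rightarrow> nat \<Rightarrow> nat \<Rightarrow> nat \<Rightarrow> nat \<Rightarrow> bool" where
  "bibd X \<B> v b r k l \<longleftrightarrow>
     finite X \<and> X \<noteq> {} \<and> card X = v \<and>
     \<B> \<subseteq> Pow X \<and> card \<B> = b \<and>
     (\<forall>B\<in>\<B>. card B = k) \<and>
     (\<forall>x\<in>X. card {B \<in> \<B>. x \<in> B} = r) \<and>
     (\<forall>x\<in>X. \<forall>y\<in>X. x \<noteq> y \<longrightarrow> card {B \<in> \<B>. x \<in> B \<and> y \<in> B} = l)"

definition symmetric_bibd ::
  "'a set \<Rightarrow> 'a set set \<Rightarrow> nat \<Rightarrow> nat \<Rightarrow> nat \<Rightarrow> nat \<Rightarrow> nat \<Rightarrow> bool" where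
  "symmetric_bibd X \<B> v b r k l \<longleftrightarrow> bibd X \<B> v b r k l \<and> v = b"

text \<open>A graph is given by its vertex set and its symmetric, irreflexive set of edges, each edge
  being present in both orientations.\<close>

definition incidence_verts :: "'a set \<Rightarrow> 'a set set \<Rightarrow> ('a + 'a set) set" where
  "incidence_verts X \<B> = X <+> \<B>"

definition incidence_edges :: "'a set \<Rightarrow> 'a set set \<Rightarrow> (('a + 'a set) \<times> ('a + 'a set)) set" where
  "incidence_edges X \<B> =
     {(Inl x, Inr B) | x B. x \<in> X \<and> B \<in> \<B> \<and> x \<in> B} \<union>
     {(Inr B, Inl x) | x B. x \<in> X \<and> B \<in> \<B> \<and> x \<in> B}"

definition graph_dist :: "('v \<times> 'v) set \<Rightarrow> 'v \<Rightarrow> 'v \<Rightarrow> enat" where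
  "graph_dist E u w = (INF n \<in> {n. (u, w) \<in> E ^^ n}. enat n)"

text \<open>A play of the robber is the sequence of positions held in rounds 0, 1, 2, and so on.\<close>

definition robber_play :: "'v set \<Rightarrow> ('v \<times> 'v) set \<Rightarrow> (nat \<Rightarrow> 'v) \<Rightarrow> bool" where
  "robber_play V E \<rho> \<longleftrightarrow>
     (\<forall>n. \<rho> n \<in> V) \<and> (\<forall>n. \<rho> (Suc n) = \<rho> n \<or> (\<rho> n, \<rho> (Suc n)) \<in> E)"

text \<open>The cops' probes may depend on the distances returned in all earlier rounds: a strategy
  maps the list of earlier answers (one list of distances per round) to the next \<open>m\<close> probes.
  Several cops may probe the same vertex.\<close>

definition cop_strategy :: "'v set \<Rightarrow> nat \<Rightarrow> (enat list list \<Rightarrow> 'v list) \<Rightarrow> bool" where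
  "cop_strategy V m \<sigma> \<longleftrightarrow> (\<forall>h. length (\<sigma> h) = m \<and> set (\<sigma> h) \<subseteq> V)"

primrec answers ::
  "('v \<times> 'v) set \<Rightarrow> (enat list list \<Rightarrow> 'v list) \<Rightarrow> (nat \<Rightarrow> 'v) \<Rightarrow> nat \<Rightarrow> enat list list" where
  "answers E \<sigma> \<rho> 0 = []"
| "answers E \<sigma> \<rho> (Suc n) =
     answers E \<sigma> \<rho> n @ [map (\<lambda>c. graph_dist E c (\<rho> n)) (\<sigma> (answers E \<sigma> \<rho> n))]"

text \<open>The robber is located in round \<open>n\<close> if every play consistent with the answers of rounds
  0 to \<open>n\<close> occupies the same vertex in round \<open>n\<close>.\<close>

definition located ::
  "'v set \<Rightarrow> ('v \<times> 'v) set \<Rightarrow> (enat list list \<Rightarrow> 'v list) \<Rightarrow> (nat \<Rightarrow> 'v) \<Rightarrow> nat \<Rightarrow> bool" where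
  "located V E \<sigma> \<rho> n \<longleftrightarrow>
     (\<forall>\<rho>'. robber_play V E \<rho>' \<and> answers E \<sigma> \<rho>' (Suc n) = answers E \<sigma> \<rho> (Suc n)
        \<longrightarrow> \<rho>' n = \<rho> n)"

definition cops_win :: "'v set \<Rightarrow> ('v \<times> 'v) set \<Rightarrow> nat \<Rightarrow> bool" where
  "cops_win V E m \<longleftrightarrow>
     (\<exists>\<sigma>. cop_strategy V m \<sigma> \<and> (\<forall>\<rho>. robber_play V E \<rho> \<longrightarrow> (\<exists>n. located V E \<sigma> \<rho> n)))"

definition localization_number :: "'v set \<Rightarrow> ('v \<times> 'v) set \<Rightarrow> nat" where
  "localization_number V E = (LEAST m. cops_win V E m)"

text \<open>On a finite graph the minimum is attained: probing all vertices locates the robber.\<close>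

lemma graph_dist_eq_0_iff: "graph_dist E u w = 0 \<longleftrightarrow> u = w"
proof
  assume "graph_dist E u w = 0"
  then have z: "Inf (enat ` {n. (u, w) \<in> E ^^ n}) = 0"
    by (simp add: graph_dist_def)
  then have "enat ` {n. (u, w) \<in> E ^^ n} \<noteq> {}"
    by (force simp: Inf_enat_def split: if_splits)
  then have "Inf (enat ` {n. (u, w) \<in> E ^^ n}) \<in> enat ` {n. (u, w) \<in> E ^^ n}"
    unfolding Inf_enat_def by (metis (mono_tags, lifting) LeastI ex_in_conv)
  then show "u = w"
    using z by (auto simp: zero_enat_def)
next
  assume "u = w"
  then have "0 \<in> enat ` {n. (u, w) \<in> E ^^ n}"
    by (auto simp: zero_enat_def image_iff intro!: exI[of _ 0])
  then show "graph_dist E u w = 0"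
    unfolding graph_dist_def by (metis Inf_lower le_zero_eq)
qed

lemma cops_win_card:
  assumes "finite V"
  shows "cops_win V E (card V)"
proof -
  obtain vs where vs: "set vs = V" "distinct vs"
    using assms finite_distinct_list by blast
  define \<sigma> where "\<sigma> = (\<lambda>h :: enat list list. vs)"
  have "cop_strategy V (card V) \<sigma>"
    using vs by (auto simp: cop_strategy_def \<sigma>_def distinct_card)
  moreover have "located V E \<sigma> \<rho> 0" if "robber_play V E \<rho>" for \<rho>
    unfolding located_def
  proof (intro allI impI)
    fix \<rho>' assume *: "robber_play V E \<rho>' \<and> answers E \<sigma> \<rho>' (Suc 0) = answers E \<sigma> \<rho> (Suc 0)"
    then have "\<forall>c\<in>V. graph_dist E c (\<rho>' 0) = graph_dist E c (\<rho> 0)"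
      using vs by (simp add: \<sigma>_def)
    moreover have "\<rho> 0 \<in> V"
      using that by (simp add: robber_play_def)
    ultimately show "\<rho>' 0 = \<rho> 0"
      by (metis graph_dist_eq_0_iff)
  qed
  ultimately show ?thesis
    unfolding cops_win_def by blast
qed

end

theory Submission
  imports Defs
begin

text \<open>
  The incidence graph is that of a (possibly degenerate) projective plane of order \<open>k - 1\<close>: any
  two points lie on one block and any two blocks meet in one point, so distances only record
  equality and incidence. The robber always keeps two vertices of the same kind, say points
  \<open>p\<close> and \<open>q\<close>, that the answers so far do not separate. A probe distinguishes at most one of the
  \<open>k\<close> blocks through \<open>p\<close> from the others, and likewise for \<open>q\<close>, so fewer than \<open>k\<close> probes leave an
  undistinguished block through each. If some probe distinguishes nothing at \<open>p\<close> or at \<open>q\<close>, two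
  undistinguished blocks through that point survive. Otherwise neither \<open>p\<close> nor \<open>q\<close> is probed and
  the only block that can be probed is the one joining them: if it is probed, the undistinguished
  blocks through \<open>p\<close> and \<open>q\<close> differ; if it is not, only points other than \<open>p\<close> and \<open>q\<close> are
  probed, and \<open>p\<close>, \<open>q\<close> themselves survive.
\<close>

section \<open>Evasion\<close>

text \<open>Tracing predecessors back from ever later levels gives chains of every finite length. As
  the levels are finite, one can always step to an element that still has continuations of all
  lengths.\<close>

lemma koenig_chain:
  fixes S :: "nat \<Rightarrow> 'a set"
  assumes fin: "\<And>n. finite (S n)" and ne: "\<And>n. S n \<noteq> {}"
    and pred: "\<And>n y. y \<in> S (Suc n) \<Longrightarrow> \<exists>x\<in>S n. R x y"
  shows "\<exists>f. \<forall>n. f n \<in> S n \<and> R (f n) (f (Suc n))"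
proof -
  \<comment> \<open>\<open>ext j n x\<close>: from \<open>x\<close> in \<open>S n\<close> a chain
    runs through \<open>j\<close> further levels.\<close>
  define ext where "ext = rec_nat (\<lambda>n x. x \<in> S n)
    (\<lambda>j e n x. x \<in> S n \<and> (\<exists>y. R x y \<and> e (Suc n) y))"
  have ext0: "ext 0 n x \<longleftrightarrow> x \<in> S n" for n x
    by (simp add: ext_def)
  have extS: "ext (Suc j) n x \<longleftrightarrow> x \<in> S n \<and> (\<exists>y. R x y \<and> ext j (Suc n) y)" for j n x
    by (simp add: ext_def)
  have in_S: "x \<in> S n" if "ext j n x" for j n x
    using that by (cases j) (auto simp: ext0 extS)
  have ext_Suc: "ext (Suc j) n x \<Longrightarrow> ext j n x" for j n x
  proof (induction j arbitrary: n x)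
    case 0
    then show ?case by (simp add: ext0 extS)
  next
    case (Suc j)
    then show ?case by (metis extS)
  qed
  have anti: "ext j n x" if "ext i n x" "j \<le> i" for i j n x
    using that(2,1) by (induction rule: dec_induct) (auto intro: ext_Suc)
  \<comment> \<open>This exchanges quantifiers, from an \<open>x\<close> for each \<open>j\<close>
    to one \<open>x\<close> for all \<open>j\<close>: otherwise each \<open>x\<close> fails at some
    length \<open>J x\<close>, and at the maximum of these over the finite level none is
    left.\<close>
  have pigeon: "\<exists>x. Q x \<and> (\<forall>j. ext j n x)" if *: "\<And>j. \<exists>x. Q x \<and> ext j n x" for Q n
  proof (rule ccontr)
    assume "\<not> ?thesis"
    then obtain J where J: "\<And>x. Q x \<Longrightarrow> \<not> ext (J x) n x"
      by metis
    obtain x where x: "Q x" "ext (Max (J ` S n)) n x"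
      using * by blast
    have "J x \<le> Max (J ` S n)"
      using fin in_S[OF x(2)] by simp
    then show False
      using J x anti by blast
  qed
  have ex: "\<exists>x. ext j n x" for j n
  proof (induction j arbitrary: n)
    case 0
    then show ?case using ne by (auto simp: ext0)
  next
    case (Suc j)
    then show ?case using pred in_S by (metis extS)
  qed
  have "\<exists>f. \<forall>n. (\<forall>j. ext j n (f n)) \<and> R (f n) (f (Suc n))"
  proof (rule dependent_nat_choice)
    show "\<exists>x. \<forall>j. ext j 0 x"
      using pigeon[of "\<lambda>_. True" 0] ex by simp
  next
    fix x n assume "\<forall>j. ext j n x"
    then show "\<exists>y. (\<forall>j. ext j (Suc n) y) \<and> R x y"
      using pigeon[of "R x" "Suc n"] extS by meson
  qed
  then show ?thesis
    using in_S by meson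
qed

text \<open>The robber cannot follow the candidate sets greedily, since a candidate may have no
  surviving successor; a single infinite play through all of them is found by Koenig's lemma.\<close>

lemma not_cops_winI:
  fixes V :: "'a set"
  assumes step: "\<And>S c. S \<in> P \<Longrightarrow> length c = m \<Longrightarrow> set c \<subseteq> V \<Longrightarrow>
      \<exists>T\<in>P. (\<forall>y\<in>T. \<exists>x\<in>S. x = y \<or> (x, y) \<in> E) \<and>
        (\<forall>d\<in>set c. \<forall>x\<in>T. \<forall>y\<in>T. graph_dist E d x = graph_dist E d y)"
    and P: "\<And>S. S \<in> P \<Longrightarrow> finite S \<and> S \<subseteq> V \<and> (\<forall>x\<in>S. \<exists>y\<in>S. y \<noteq> x) \<and> S \<noteq> {}"
    and init: "S0 \<in> P"
  shows "\<not> cops_win V E m"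
proof
  assume "cops_win V E m"
  then obtain \<sigma> where \<sigma>: "\<And>h. length (\<sigma> h) = m" "\<And>h. set (\<sigma> h) \<subseteq> V"
    and win: "\<And>\<rho>. robber_play V E \<rho> \<Longrightarrow> \<exists>n. located V E \<sigma> \<rho> n"
    by (auto simp: cops_win_def cop_strategy_def)
  define ok where "ok S h T \<longleftrightarrow> T \<in> P \<and> (\<forall>y\<in>T. \<exists>x\<in>S. x = y \<or> (x, y) \<in> E) \<and>
        (\<forall>d\<in>set (\<sigma> h). \<forall>x\<in>T. \<forall>y\<in>T. graph_dist E d x = graph_dist E d y)" for S h T
  \<comment> \<open>All members of \<open>T\<close> give the same answers to
    \<open>\<sigma> h\<close> once \<open>ok S h T\<close> holds, so any member may represent
    them.\<close>
  define reply where "reply h T = h @ [map (\<lambda>c. graph_dist E c (SOME x. x \<in> T)) (\<sigma> h)]" for h T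
  have ok_ex: "\<exists>T. ok S h T" if "S \<in> P" for S h
    using step[OF that \<sigma>(1) \<sigma>(2)] unfolding ok_def by blast
  have reply: "reply h T = h @ [map (\<lambda>c. graph_dist E c x) (\<sigma> h)]" if "ok S h T" "x \<in> T" for S h T x
  proof -
    have "(SOME x. x \<in> T) \<in> T"
      using that by (meson someI)
    then have "\<forall>c\<in>set (\<sigma> h). graph_dist E c (SOME x. x \<in> T) = graph_dist E c x"
      using that unfolding ok_def by blast
    then show ?thesis
      by (simp add: reply_def)
  qed
  \<comment> \<open>The state \<open>s n\<close> pairs the candidates in round \<open>n\<close> with
    the answers of the rounds before \<open>n\<close>. \<open>S0\<close> is the reservoir from which
    the candidates of round 0 are drawn.\<close>
  have "\<exists>s. \<forall>n. (fst (s n) \<in> P \<and> (n = 0 \<longrightarrow> snd (s n) = [] \<and> ok S0 [] (fst (s n)))) \<and>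
      (snd (s (Suc n)) = reply (snd (s n)) (fst (s n)) \<and>
       ok (fst (s n)) (snd (s (Suc n))) (fst (s (Suc n))))"
  proof (rule dependent_nat_choice)
    show "\<exists>s. fst s \<in> P \<and> (0 = (0::nat) \<longrightarrow> snd s = [] \<and> ok S0 [] (fst s))"
      using ok_ex[OF init, of "[]"] unfolding ok_def by auto
  next
    fix s :: "'a set \<times> enat list list" and n :: nat
    assume "fst s \<in> P \<and> (n = 0 \<longrightarrow> snd s = [] \<and> ok S0 [] (fst s))"
    then obtain T where T: "ok (fst s) (reply (snd s) (fst s)) T"
      using ok_ex by blast
    then have "T \<in> P" by (simp add: ok_def)
    with T show "\<exists>t. (fst t \<in> P \<and> (Suc n = 0 \<longrightarrow> snd t = [] \<and> ok S0 [] (fst t))) \<and>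
       snd t = reply (snd s) (fst s) \<and> ok (fst s) (snd t) (fst t)"
      by (intro exI[of _ "(T, reply (snd s) (fst s))"]) simp
  qed
  then obtain s where s: "\<And>n. fst (s n) \<in> P" "snd (s 0) = []" "ok S0 [] (fst (s 0))"
      "\<And>n. snd (s (Suc n)) = reply (snd (s n)) (fst (s n))"
      "\<And>n. ok (fst (s n)) (snd (s (Suc n))) (fst (s (Suc n)))"
    by metis
  define T where "T n = fst (s n)" for n
  define h where "h n = snd (s n)" for n
  have TP: "T n \<in> P" for n
    using s(1) by (simp add: T_def)
  have h0: "h 0 = []" using s(2) by (simp add: h_def)
  have hS: "h (Suc n) = h n @ [map (\<lambda>c. graph_dist E c x) (\<sigma> (h n))]" if "x \<in> T n" for n x
  proof -
    have "\<exists>S. ok S (h n) (T n)"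
      using s(2,3,5) by (cases n) (auto simp: T_def h_def)
    then show ?thesis
      using reply that s(4) by (auto simp: T_def h_def)
  qed
  have pred: "\<exists>x\<in>T n. x = y \<or> (x, y) \<in> E" if "y \<in> T (Suc n)" for n y
    using s(5)[of n] that by (simp add: ok_def T_def)
  \<comment> \<open>The answers are the same for every play that stays within the candidate
    sets.\<close>
  have ans: "answers E \<sigma> \<rho> n = h n" if "\<And>i. i < n \<Longrightarrow> \<rho> i \<in> T i" for \<rho> n
    using that by (induction n) (simp_all add: h0 hS[symmetric])
  \<comment> \<open>Each candidate of round \<open>n\<close> is the end of a walk through all
    earlier candidate sets; resting there afterwards makes it an infinite play.\<close>
  have trace: "\<exists>\<rho>. (\<forall>i\<le>n. \<rho> i \<in> T i) \<and> (\<forall>i\<ge>n. \<rho> i = y) \<and>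
      (\<forall>i. \<rho> (Suc i) = \<rho> i \<or> (\<rho> i, \<rho> (Suc i)) \<in> E)" if "y \<in> T n" for n y
    using that
  proof (induction n arbitrary: y)
    case 0
    then show ?case by (intro exI[of _ "\<lambda>_. y"]) auto
  next
    case (Suc n)
    obtain x where x: "x \<in> T n" "x = y \<or> (x, y) \<in> E"
      using pred[OF Suc.prems] by blast
    obtain \<rho> where \<rho>: "\<And>i. i \<le> n \<Longrightarrow> \<rho> i \<in> T i" "\<And>i. n \<le> i \<Longrightarrow> \<rho> i = x"
        "\<And>i. \<rho> (Suc i) = \<rho> i \<or> (\<rho> i, \<rho> (Suc i)) \<in> E"
      using Suc.IH[OF x(1)] by blast
    have "\<rho> n = x" using \<rho>(2) by simp
    then have "(if Suc i \<le> n then \<rho> (Suc i) else y) = (if i \<le> n then \<rho> i else y) \<or>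
       ((if i \<le> n then \<rho> i else y), (if Suc i \<le> n then \<rho> (Suc i) else y)) \<in> E" for i
      using \<rho>(3)[of i] x(2) by (cases "i = n") auto
    then show ?case
      using \<rho>(1) Suc.prems by (intro exI[of _ "\<lambda>i. if i \<le> n then \<rho> i else y"]) (auto simp: le_Suc_eq)
  qed
  have "\<exists>\<rho>. \<forall>n. \<rho> n \<in> T n \<and> (\<rho> n = \<rho> (Suc n) \<or> (\<rho> n, \<rho> (Suc n)) \<in> E)"
    using P[OF TP] pred by (intro koenig_chain) simp_all
  then obtain \<rho> where \<rho>: "\<And>n. \<rho> n \<in> T n" "\<And>n. \<rho> n = \<rho> (Suc n) \<or> (\<rho> n, \<rho> (Suc n)) \<in> E"
    by blast
  have TV: "T n \<subseteq> V" for n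
    using P[OF TP] by blast
  have "robber_play V E \<rho>"
    unfolding robber_play_def using \<rho> TV by (metis subsetD)
  then obtain n where n: "located V E \<sigma> \<rho> n"
    using win by blast
  obtain y where y: "y \<in> T n" "y \<noteq> \<rho> n"
    using P[OF TP] \<rho>(1) by blast
  \<comment> \<open>Up to round \<open>n\<close> both plays stay among the candidates, so they yield
    equal answers although they end at different vertices.\<close>
  obtain \<rho>' where \<rho>': "\<And>i. i \<le> n \<Longrightarrow> \<rho>' i \<in> T i" "\<And>i. n \<le> i \<Longrightarrow> \<rho>' i = y"
      "\<And>i. \<rho>' (Suc i) = \<rho>' i \<or> (\<rho>' i, \<rho>' (Suc i)) \<in> E"
    using trace[OF y(1)] by blast
  have "\<rho>' i \<in> V" for i
    using \<rho>'(1)[of i] \<rho>'(2)[of i] TV y(1) by (cases "i \<le> n") auto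
  then have "robber_play V E \<rho>'"
    using \<rho>'(3) by (simp add: robber_play_def)
  moreover have "answers E \<sigma> \<rho>' (Suc n) = answers E \<sigma> \<rho> (Suc n)"
    using ans[of "Suc n" \<rho>'] ans[of "Suc n" \<rho>] \<rho>(1) \<rho>'(1) by simp
  ultimately have "\<rho>' n = \<rho> n"
    using n unfolding located_def by blast
  then show False
    using \<rho>'(2) y(2) by simp
qed

section \<open>Incidence graphs of projective planes\<close>

lemma graph_dist_eqI:
  assumes "(u, w) \<in> E ^^ n" and "\<And>i. i < n \<Longrightarrow> (u, w) \<notin> E ^^ i"
  shows "graph_dist E u w = enat n"
  unfolding graph_dist_def
proof (rule antisym)
  show "(INF i\<in>{i. (u, w) \<in> E ^^ i}. enat i) \<le> enat n"
    using assms(1) by (intro INF_lower) simp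
  show "enat n \<le> (INF i\<in>{i. (u, w) \<in> E ^^ i}. enat i)"
    using assms(2) by (intro INF_greatest) (auto simp: not_less[symmetric])
qed

text \<open>The two sides play the same role, so that every fact about points dualises to blocks.\<close>

locale plane_graph =
  fixes A C :: "'v set" and E :: "('v \<times> 'v) set" and k :: nat
  assumes finite: "finite A" "finite C"
    and sym: "sym E"
    and disjoint: "A \<inter> C = {}"
    and bipartite: "E \<subseteq> A \<times> C \<union> C \<times> A"
    and pos: "k > 0"
    and degree: "\<And>x. x \<in> A \<union> C \<Longrightarrow> card (E `` {x}) = k"
    and join: "\<And>x y. x \<in> A \<Longrightarrow> y \<in> A \<Longrightarrow> x \<noteq> y \<Longrightarrow> \<exists>!z. (x, z) \<in> E \<and> (y, z) \<in> E"
    and meet: "\<And>x y. x \<in> C \<Longrightarrow> y \<in> C \<Longrightarrow> x \<noteq> y \<Longrightarrow> \<exists>!z. (x, z) \<in> E \<and> (y, z) \<in> E"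
begin

lemma dual: "plane_graph C A E k"
  using finite sym disjoint bipartite pos degree join meet by unfold_locales auto

lemma edge_sym: "(x, y) \<in> E \<Longrightarrow> (y, x) \<in> E"
  using sym by (rule symD)

lemma finite_star: "finite (E `` {x})"
  using finite bipartite by (auto intro: finite_subset[of _ "A \<union> C"])

lemma star_nonempty: "x \<in> A \<union> C \<Longrightarrow> E `` {x} \<noteq> {}"
  using degree pos by fastforce

lemma star_subset: "x \<in> A \<Longrightarrow> E `` {x} \<subseteq> C"
  using bipartite disjoint by auto

section \<open>Distances in the incidence graph\<close>

lemma dist_same_side:
  assumes "x \<in> A" "y \<in> A" "x \<noteq> y"
  shows "graph_dist E x y = 2"
proof -
  obtain z where z: "(x, z) \<in> E" "(y, z) \<in> E"
    using join[OF assms] by blast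
  have "graph_dist E x y = enat (Suc (Suc 0))"
  proof (rule graph_dist_eqI)
    show "(x, y) \<in> E ^^ Suc (Suc 0)"
      using z edge_sym by auto
    show "(x, y) \<notin> E ^^ i" if "i < Suc (Suc 0)" for i
      using that assms bipartite disjoint by (auto simp: less_Suc_eq)
  qed
  then show ?thesis
    by (simp add: numeral_2_eq_2[symmetric] numeral_eq_enat)
qed

lemma dist_incident:
  assumes "(x, y) \<in> E"
  shows "graph_dist E x y = 1"
proof -
  have "x \<noteq> y"
    using assms bipartite disjoint by auto
  then have "graph_dist E x y = enat (Suc 0)"
    using assms by (intro graph_dist_eqI) (auto simp: less_Suc_eq)
  then show ?thesis
    by (simp add: one_enat_def)
qed

text \<open>A path of length 3 runs from \<open>x\<close> along the block joining it to some point
  \<open>z\<close> of \<open>y\<close>; parity excludes length 2.\<close>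

lemma dist_nonincident:
  assumes "x \<in> A" "y \<in> C" "(x, y) \<notin> E"
  shows "graph_dist E x y = 3"
proof -
  obtain z where z: "(y, z) \<in> E"
    using star_nonempty assms(2) by auto
  then have "z \<in> A" "z \<noteq> x"
    using assms bipartite disjoint edge_sym by auto
  then obtain w where w: "(x, w) \<in> E" "(z, w) \<in> E"
    using join assms(1) by metis
  have "graph_dist E x y = enat (Suc (Suc (Suc 0)))"
  proof (rule graph_dist_eqI)
    show "(x, y) \<in> E ^^ Suc (Suc (Suc 0))"
      using z w edge_sym by (auto simp: relcomp_unfold)
    have "(w', y) \<notin> E" if "(x, w') \<in> E" for w'
      using that assms bipartite disjoint by blast
    then show "(x, y) \<notin> E ^^ i" if "i < Suc (Suc (Suc 0))" for i
      using that assms disjoint by (auto simp: less_Suc_eq)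
  qed
  then show ?thesis
    by (simp add: numeral_3_eq_3[symmetric] numeral_eq_enat)
qed

section \<open>Neighbours singled out by a probe\<close>

text \<open>For a point \<open>p\<close>, these are the blocks through \<open>p\<close> that a probe
  at \<open>d\<close> can tell from the others: \<open>d\<close> itself, or the block joining
  \<open>d\<close> to \<open>p\<close>. The case \<open>d = p\<close> is excluded because that probe
  reads 1 on all of them.\<close>

definition hit :: "'v \<Rightarrow> 'v \<Rightarrow> 'v set" where
  "hit p d = {l \<in> E `` {p}. l = d \<or> d \<noteq> p \<and> (d, l) \<in> E}"

lemma hit_subset_singleton:
  assumes "p \<in> A" "d \<in> A \<union> C"
  shows "\<exists>l. hit p d \<subseteq> {l}"
proof (cases "d \<in> A \<and> d \<noteq> p")
  case True
  then obtain l where "\<And>z. (p, z) \<in> E \<Longrightarrow> (d, z) \<in> E \<Longrightarrow> z = l"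
    using join[OF assms(1), of d] by blast
  then have "hit p d \<subseteq> {l}"
    using True assms(1) star_subset disjoint by (auto simp: hit_def)
  then show ?thesis ..
next
  case False
  then have "hit p d \<subseteq> {d}"
    using assms star_subset[OF assms(1)] bipartite disjoint by (auto simp: hit_def)
  then show ?thesis ..
qed

text \<open>On unhit blocks the answer depends only on the probe: 2 from a block, 1 from the common
  point \<open>p = q\<close>, 3 from any other point. If \<open>p\<close> and \<open>q\<close>
  differ, a probe at \<open>p\<close> would read 1 on \<open>l\<close> but 3 on \<open>l'\<close>,
  hence the last assumption.\<close>

lemma dist_unhit_cong:
  assumes "p \<in> A" "q \<in> A" "l \<in> E `` {p} - hit p d" "l' \<in> E `` {q} - hit q d"
    and "d \<in> A \<union> C" "p = q \<or> d \<noteq> p \<and> d \<noteq> q"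
  shows "graph_dist E d l = graph_dist E d l'"
proof -
  interpret D: plane_graph C A E k by (rule dual)
  have C: "l \<in> C" "l' \<in> C"
    using assms star_subset by blast+
  consider "d \<in> C" | "d \<in> A" "d = p" "d = q" | "d \<in> A" "d \<noteq> p" "d \<noteq> q"
    using assms(5,6) by blast
  then show ?thesis
  proof cases
    case 1
    then show ?thesis
      using assms(3,4) C by (subst (1 2) D.dist_same_side) (auto simp: hit_def)
  next
    case 2
    then show ?thesis
      using assms(3,4) by (subst (1 2) dist_incident) auto
  next
    case 3
    then show ?thesis
      using assms(3,4) C by (subst (1 2) dist_nonincident) (auto simp: hit_def)
  qed
qed

lemma card_hits:
  assumes "p \<in> A" "set c \<subseteq> A \<union> C"
  shows "card (\<Union>d\<in>set c. hit p d) \<le> card {d \<in> set c. hit p d \<noteq> {}}"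
proof -
  have "(\<Union>d\<in>set c. hit p d) = (\<Union>d\<in>{d \<in> set c. hit p d \<noteq> {}}. hit p d)"
    by blast
  also have "card \<dots> \<le> (\<Sum>d\<in>{d \<in> set c. hit p d \<noteq> {}}. card (hit p d))"
    by (rule card_UN_le) simp
  also have "\<dots> \<le> (\<Sum>d\<in>{d \<in> set c. hit p d \<noteq> {}}. 1)"
  proof (rule sum_mono)
    fix d assume "d \<in> {d \<in> set c. hit p d \<noteq> {}}"
    then obtain l where "hit p d \<subseteq> {l}"
      using hit_subset_singleton assms by blast
    then show "card (hit p d) \<le> 1"
      using card_mono[of "{l}"] by fastforce
  qed
  finally show ?thesis by simp
qed

text \<open>One of at most \<open>k - 1\<close> probes is wasted at \<open>p\<close>, so at most
  \<open>k - 2\<close> of the \<open>k\<close> blocks through \<open>p\<close> are hit.\<close>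

lemma two_unhit:
  assumes p: "p \<in> A" and c: "set c \<subseteq> A \<union> C" "length c < k" and "d \<in> set c" "hit p d = {}"
  shows "\<exists>l l'. l \<noteq> l' \<and> {l, l'} \<subseteq> E `` {p} - (\<Union>d\<in>set c. hit p d)"
proof -
  let ?H = "\<Union>d\<in>set c. hit p d"
  have "?H \<subseteq> E `` {p}"
    by (auto simp: hit_def)
  then have "card (E `` {p} - ?H) = k - card ?H"
    using finite_star degree p by (subst card_Diff_subset) (auto intro: finite_subset)
  moreover have "card {d \<in> set c. hit p d \<noteq> {}} < card (set c)"
    using assms(4,5) by (intro psubset_card_mono) auto
  then have "card ?H + 2 \<le> k"
    using card_hits[OF p c(1)] card_length[of c] c(2) by linarith
  ultimately have "2 \<le> card (E `` {p} - ?H)"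
    by linarith
  then obtain S where "S \<subseteq> E `` {p} - ?H" "card S = 2"
    by (meson obtain_subset_with_card_n)
  then show ?thesis
    by (auto simp: card_2_iff)
qed

lemma one_unhit:
  assumes p: "p \<in> A" and c: "set c \<subseteq> A \<union> C" "length c < k"
  shows "\<exists>l. l \<in> E `` {p} - (\<Union>d\<in>set c. hit p d)"
proof -
  let ?H = "\<Union>d\<in>set c. hit p d"
  have "card {d \<in> set c. hit p d \<noteq> {}} \<le> card (set c)"
    by (intro card_mono) auto
  then have "card ?H < card (E `` {p})"
    using card_hits[OF p c(1)] card_length[of c] c(2) degree[of p] p by simp
  moreover have "finite ?H"
    by (rule finite_subset[OF _ finite_star[of p]]) (auto simp: hit_def)
  ultimately show ?thesis
    by (metis card_mono ex_in_conv Diff_eq_empty_iff leD)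
qed

text \<open>One round of the game. Each new candidate needs only some predecessor in the pair, so
  both may come from the same one; lying on a common side, they form a pair to which the lemma or
  its dual applies again.\<close>

lemma evade_from_pair:
  assumes pq: "p \<in> A" "q \<in> A" "p \<noteq> q" and c: "set c \<subseteq> A \<union> C" "length c < k"
  shows "\<exists>l l'. l \<noteq> l' \<and> ({l, l'} \<subseteq> A \<or> {l, l'} \<subseteq> C) \<and>
    (\<forall>y\<in>{l, l'}. \<exists>x\<in>{p, q}. x = y \<or> (x, y) \<in> E) \<and>
    (\<forall>d\<in>set c. graph_dist E d l = graph_dist E d l')"
proof -
  have two: ?thesis if x: "x \<in> {p, q}" and d: "d \<in> set c" "hit x d = {}" for x d
  proof -
    have xA: "x \<in> A" using x pq by auto
    obtain l l' where l: "l \<noteq> l'" "{l, l'} \<subseteq> E `` {x} - (\<Union>d\<in>set c. hit x d)"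
      using two_unhit[OF xA c d] by blast
    then have "graph_dist E e l = graph_dist E e l'" if "e \<in> set c" for e
      using dist_unhit_cong[OF xA xA, of l e l'] that c(1) by blast
    moreover have "{l, l'} \<subseteq> C"
      using l(2) star_subset[OF xA] by blast
    ultimately show ?thesis
      using l x by (intro exI[of _ l] exI[of _ l']) auto
  qed
  show ?thesis
  proof (cases "\<exists>x\<in>{p, q}. \<exists>d\<in>set c. hit x d = {}")
    case True
    then show ?thesis using two by blast
  next
    case False
    then have hits: "hit p d \<noteq> {}" "hit q d \<noteq> {}" if "d \<in> set c" for d
      using that by auto
    \<comment> \<open>A probe at \<open>p\<close> or \<open>q\<close> is wasted there, which is the
      case already settled.\<close>
    have "hit x x = {}" if "x \<in> A" for x
      using star_subset[OF that] that disjoint by (auto simp: hit_def)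
    then have unprobed: "p \<notin> set c" "q \<notin> set c"
      using hits pq by blast+
    \<comment> \<open>A probed block can hit only itself, so having no wasted probe forces it
      through both \<open>p\<close> and \<open>q\<close>.\<close>
    have probed_block: "hit p d = {d} \<and> hit q d = {d}" if "d \<in> set c" "d \<in> C" for d
      using hits[OF that(1)] that(2) star_subset pq bipartite disjoint unfolding hit_def by blast
    show ?thesis
    proof (cases "set c \<inter> C = {}")
      case True
      then have "graph_dist E d p = graph_dist E d q" if "d \<in> set c" for d
        using that c(1) unprobed pq by (subst (1 2) dist_same_side) auto
      then show ?thesis
        using pq by (intro exI[of _ p] exI[of _ q]) auto
    next
      case False
      then obtain d where d: "d \<in> set c" "d \<in> C" by blast
      obtain l where l: "l \<in> E `` {p} - (\<Union>d\<in>set c. hit p d)"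
        using one_unhit[OF pq(1) c] by blast
      obtain l' where l': "l' \<in> E `` {q} - (\<Union>d\<in>set c. hit q d)"
        using one_unhit[OF pq(2) c] by blast
      have d_join: "(p, d) \<in> E" "(q, d) \<in> E" and "l \<noteq> d"
        using probed_block[OF d] d l unfolding hit_def by auto
      \<comment> \<open>Otherwise \<open>l\<close> would be a second block joining \<open>p\<close>
        and \<open>q\<close>, besides \<open>d\<close>.\<close>
      then have "l \<noteq> l'"
        using join[OF pq] l l' by auto
      moreover have "graph_dist E e l = graph_dist E e l'" if "e \<in> set c" for e
        using dist_unhit_cong[OF pq(1,2), of l e l'] that c(1) unprobed l l' by blast
      moreover have "{l, l'} \<subseteq> C"
        using l l' star_subset pq by blast
      ultimately show ?thesis
        using l l' by (intro exI[of _ l] exI[of _ l']) auto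
    qed
  qed
qed

lemma not_cops_win_plane:
  assumes "m < k" "p \<in> A" "q \<in> A" "p \<noteq> q"
  shows "\<not> cops_win (A \<union> C) E m"
proof (rule not_cops_winI)
  \<comment> \<open>The robber's invariant: two distinct vertices on the same side.\<close>
  let ?P = "{{x, y} | x y. x \<noteq> y \<and> ({x, y} \<subseteq> A \<or> {x, y} \<subseteq> C)}"
  interpret D: plane_graph C A E k by (rule dual)
  show "{p, q} \<in> ?P" using assms by blast
  show "finite S \<and> S \<subseteq> A \<union> C \<and> (\<forall>x\<in>S. \<exists>y\<in>S. y \<noteq> x) \<and> S \<noteq> {}" if "S \<in> ?P" for S
    using that by auto
  show "\<exists>T\<in>?P. (\<forall>y\<in>T. \<exists>x\<in>S. x = y \<or> (x, y) \<in> E) \<and>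
        (\<forall>d\<in>set c. \<forall>x\<in>T. \<forall>y\<in>T. graph_dist E d x = graph_dist E d y)"
    if S: "S \<in> ?P" and c: "length c = m" "set c \<subseteq> A \<union> C" for S c
  proof -
    obtain x y where xy: "S = {x, y}" "x \<noteq> y" "{x, y} \<subseteq> A \<or> {x, y} \<subseteq> C"
      using S by blast
    have "\<exists>l l'. l \<noteq> l' \<and> ({l, l'} \<subseteq> A \<or> {l, l'} \<subseteq> C) \<and>
        (\<forall>z\<in>{l, l'}. \<exists>w\<in>{x, y}. w = z \<or> (w, z) \<in> E) \<and>
        (\<forall>d\<in>set c. graph_dist E d l = graph_dist E d l')"
      using xy(3)
    proof
      assume "{x, y} \<subseteq> A"
      then show ?thesis
        using evade_from_pair[of x y c] xy(2) c assms(1) by auto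
    next
      assume "{x, y} \<subseteq> C"
      moreover have "set c \<subseteq> C \<union> A" using c by blast
      ultimately show ?thesis
        using D.evade_from_pair[of x y c] xy(2) c(1) assms(1)
        by (simp only: insert_subset empty_subsetI disj_commute) blast
    qed
    then obtain l l' where "l \<noteq> l'" "{l, l'} \<subseteq> A \<or> {l, l'} \<subseteq> C"
      "\<forall>z\<in>{l, l'}. \<exists>w\<in>S. w = z \<or> (w, z) \<in> E"
      "\<forall>d\<in>set c. graph_dist E d l = graph_dist E d l'"
      unfolding xy(1) by blast
    then show ?thesis
      by (intro bexI[of _ "{l, l'}"]) auto
  qed
qed

end

section \<open>Symmetric designs\<close>

lemma sum_card_filter_swap:
  assumes "finite S" "finite T"
  shows "(\<Sum>x\<in>S. card {y \<in> T. R x y}) = (\<Sum>y\<in>T. card {x \<in> S. R x y})"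
  using sum.swap_restrict[OF assms, of "\<lambda>_ _. 1::nat" R] by simp

lemma bibd_finite_blocks: "bibd X \<B> v b r k l \<Longrightarrow> finite \<B>"
  unfolding bibd_def by (meson finite_Pow_iff finite_subset)

lemma bibd_block_finite: "bibd X \<B> v b r k l \<Longrightarrow> B \<in> \<B> \<Longrightarrow> finite B"
  unfolding bibd_def by (meson PowD finite_subset subsetD)

lemma bibd_incidences:
  assumes D: "bibd X \<B> v b r k l"
  shows "v * r = b * k"
proof -
  have "(\<Sum>x\<in>X. card {B \<in> \<B>. x \<in> B}) = (\<Sum>B\<in>\<B>. card {x \<in> X. x \<in> B})"
    using D bibd_finite_blocks[OF D] by (intro sum_card_filter_swap) (auto simp: bibd_def)
  moreover have "(\<Sum>x\<in>X. card {B \<in> \<B>. x \<in> B}) = v * r"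
    using D by (simp add: bibd_def)
  moreover have "{x \<in> X. x \<in> B} = B" if "B \<in> \<B>" for B
    using D that by (auto simp: bibd_def)
  then have "(\<Sum>B\<in>\<B>. card {x \<in> X. x \<in> B}) = b * k"
    using D by (simp add: bibd_def)
  ultimately show ?thesis by simp
qed

text \<open>Fix a point \<open>x\<close> and count the pairs of another point \<open>y\<close> and a
  block containing both, once by \<open>y\<close> and once by the block.\<close>

lemma bibd_flags_at_point:
  assumes D: "bibd X \<B> v b r k l"
  shows "(v - 1) * l = r * (k - 1)"
proof -
  obtain x where x: "x \<in> X" using D by (auto simp: bibd_def)
  let ?Bx = "{B \<in> \<B>. x \<in> B}"
  have "(\<Sum>y\<in>X - {x}. card {B \<in> ?Bx. y \<in> B}) = (\<Sum>B\<in>?Bx. card {y \<in> X - {x}. y \<in> B})"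
    using D bibd_finite_blocks[OF D] by (intro sum_card_filter_swap) (auto simp: bibd_def)
  moreover have "card {B \<in> ?Bx. y \<in> B} = l" if "y \<in> X - {x}" for y
    using D x that by (auto simp: bibd_def)
  then have "(\<Sum>y\<in>X - {x}. card {B \<in> ?Bx. y \<in> B}) = (v - 1) * l"
    using D x by (simp add: bibd_def)
  moreover have "card {y \<in> X - {x}. y \<in> B} = k - 1" if "B \<in> ?Bx" for B
  proof -
    have "{y \<in> X - {x}. y \<in> B} = B - {x}"
      using D that by (auto simp: bibd_def)
    then show ?thesis
      using D that bibd_block_finite[OF D] by (simp add: bibd_def)
  qed
  then have "(\<Sum>B\<in>?Bx. card {y \<in> X - {x}. y \<in> B}) = r * (k - 1)"
    using D x by (simp add: bibd_def)
  ultimately show ?thesis by simp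
qed

lemma symmetric_bibd_replication:
  assumes "symmetric_bibd X \<B> v b r k l"
  shows "r = k"
proof -
  have D: "bibd X \<B> v v r k l"
    using assms by (auto simp: symmetric_bibd_def)
  then have "v > 0"
    by (auto simp: bibd_def card_gt_0_iff)
  then show ?thesis
    using bibd_incidences[OF D] by simp
qed

lemma bibd_1_block_inter:
  assumes D: "bibd X \<B> v b r k 1" and B: "B \<in> \<B>" "B' \<in> \<B>" "B \<noteq> B'"
  shows "card (B \<inter> B') \<le> 1"
proof (rule ccontr)
  assume "\<not> ?thesis"
  then obtain S where "S \<subseteq> B \<inter> B'" "card S = 2"
    by (metis Suc_1 not_less_eq_eq obtain_subset_with_card_n)
  then obtain x y where xy: "x \<noteq> y" "x \<in> B \<inter> B'" "y \<in> B \<inter> B'"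
    by (auto simp: card_2_iff)
  then have "x \<in> X" "y \<in> X"
    using D B by (auto simp: bibd_def)
  then have "card {C \<in> \<B>. x \<in> C \<and> y \<in> C} = 1"
    using D xy(1) by (simp add: bibd_def)
  moreover have "B \<in> {C \<in> \<B>. x \<in> C \<and> y \<in> C}" "B' \<in> {C \<in> \<B>. x \<in> C \<and> y \<in> C}"
    using B xy by auto
  ultimately show False
    using B(3) by (metis card_1_singletonE singletonD)
qed

text \<open>The other blocks meet \<open>B\<close> in \<open>k * (k - 1) = b - 1\<close> flags altogether and in at most one
  point each, hence in exactly one.\<close>

lemma symmetric_bibd_1_block_inter:
  assumes S: "symmetric_bibd X \<B> v b r k 1" and B: "B \<in> \<B>" "B' \<in> \<B>" "B \<noteq> B'"
  shows "card (B \<inter> B') = 1"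
proof -
  have rk: "r = k" using symmetric_bibd_replication[OF S] .
  have D: "bibd X \<B> v v k k 1"
    using S rk by (auto simp: symmetric_bibd_def)
  have fin: "finite \<B>" "finite B"
    using bibd_finite_blocks[OF D] bibd_block_finite[OF D B(1)] .
  have "(\<Sum>x\<in>B. card {C \<in> \<B> - {B}. x \<in> C}) = (\<Sum>C\<in>\<B> - {B}. card {x \<in> B. x \<in> C})"
    using fin by (intro sum_card_filter_swap) auto
  moreover have "card {C \<in> \<B> - {B}. x \<in> C} = k - 1" if "x \<in> B" for x
  proof -
    have "{C \<in> \<B> - {B}. x \<in> C} = {C \<in> \<B>. x \<in> C} - {B}" by blast
    moreover have "x \<in> X" using D B that by (auto simp: bibd_def)
    ultimately show ?thesis
      using D B that by (simp add: bibd_def)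
  qed
  then have "(\<Sum>x\<in>B. card {C \<in> \<B> - {B}. x \<in> C}) = k * (k - 1)"
    using D B by (simp add: bibd_def)
  moreover have "card (\<B> - {B}) = k * (k - 1)"
    using bibd_flags_at_point[OF D] D B by (simp add: bibd_def)
  moreover have "{x \<in> B. x \<in> C} = B \<inter> C" for C by blast
  ultimately have total: "(\<Sum>C\<in>\<B> - {B}. card (B \<inter> C)) = (\<Sum>C\<in>\<B> - {B}. 1)"
    by simp
  show ?thesis
  proof (rule ccontr)
    assume "\<not> ?thesis"
    then have "card (B \<inter> B') < 1"
      using bibd_1_block_inter[OF D B] by simp
    then have "(\<Sum>C\<in>\<B> - {B}. card (B \<inter> C)) < (\<Sum>C\<in>\<B> - {B}. 1)"
      using fin B bibd_1_block_inter[OF D B(1)]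
      by (intro sum_strict_mono_ex1) auto
    then show False
      using total by simp
  qed
qed

text \<open>Symmetry enters twice: \<open>r = k\<close> makes the graph regular, and any two blocks
  meet in exactly one point, which is the dual of the joining axiom.\<close>

lemma symmetric_bibd_plane_graph:
  assumes S: "symmetric_bibd X \<B> v b r k 1" and "k > 0"
  shows "plane_graph (Inl ` X) (Inr ` \<B>) (incidence_edges X \<B>) k"
proof -
  let ?E = "incidence_edges X \<B>"
  have D: "bibd X \<B> v v k k 1"
    using S symmetric_bibd_replication[OF S] by (auto simp: symmetric_bibd_def)
  have sub: "B \<subseteq> X" if "B \<in> \<B>" for B
    using D that by (auto simp: bibd_def)
  have Inl_E: "(Inl x, z) \<in> ?E \<longleftrightarrow> (\<exists>B\<in>\<B>. z = Inr B \<and> x \<in> B)" for x z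
    using sub by (auto simp: incidence_edges_def)
  have Inr_E: "(Inr B, z) \<in> ?E \<longleftrightarrow> B \<in> \<B> \<and> (\<exists>x\<in>B. z = Inl x)" for B z
    using sub by (auto simp: incidence_edges_def)
  show ?thesis
  proof
    show "finite (Inl ` X)" "finite (Inr ` \<B>)"
      using D bibd_finite_blocks[OF D] by (auto simp: bibd_def)
    show "sym ?E"
      by (auto simp: sym_def incidence_edges_def)
    show "Inl ` X \<inter> Inr ` \<B> = {}"
      by blast
    show "?E \<subseteq> Inl ` X \<times> Inr ` \<B> \<union> Inr ` \<B> \<times> Inl ` X"
      by (auto simp: incidence_edges_def)
    show "k > 0" by fact
    show "card (?E `` {u}) = k" if "u \<in> Inl ` X \<union> Inr ` \<B>" for u
      using that
    proof
      assume "u \<in> Inl ` X"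
      then obtain x where x: "x \<in> X" "u = Inl x" by blast
      then have "?E `` {u} = Inr ` {B \<in> \<B>. x \<in> B}"
        by (auto simp: Inl_E)
      then show ?thesis
        using D x by (simp add: card_image bibd_def)
    next
      assume "u \<in> Inr ` \<B>"
      then obtain B where B: "B \<in> \<B>" "u = Inr B" by blast
      then have "?E `` {u} = Inl ` B"
        by (auto simp: Inr_E)
      then show ?thesis
        using D B by (simp add: card_image bibd_def)
    qed
    show "\<exists>!z. (u, z) \<in> ?E \<and> (w, z) \<in> ?E" if uw: "u \<in> Inl ` X" "w \<in> Inl ` X" "u \<noteq> w" for u w
    proof -
      obtain x y where xy: "x \<in> X" "y \<in> X" "u = Inl x" "w = Inl y" "x \<noteq> y"
        using uw by blast
      then have "card {B \<in> \<B>. x \<in> B \<and> y \<in> B} = 1"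
        using D by (simp add: bibd_def)
      then obtain B where "{B \<in> \<B>. x \<in> B \<and> y \<in> B} = {B}"
        by (rule card_1_singletonE)
      then show ?thesis
        unfolding xy(3,4) Inl_E by (intro ex1I[of _ "Inr B"]) blast+
    qed
    show "\<exists>!z. (u, z) \<in> ?E \<and> (w, z) \<in> ?E" if uw: "u \<in> Inr ` \<B>" "w \<in> Inr ` \<B>" "u \<noteq> w" for u w
    proof -
      obtain B B' where B: "B \<in> \<B>" "B' \<in> \<B>" "u = Inr B" "w = Inr B'" "B \<noteq> B'"
        using uw by blast
      then have "card (B \<inter> B') = 1"
        using symmetric_bibd_1_block_inter[OF S] by simp
      then obtain x where "B \<inter> B' = {x}"
        by (rule card_1_singletonE)
      then show ?thesis
        using B(1,2) unfolding B(3,4) Inr_E by (intro ex1I[of _ "Inl x"]) blast+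
    qed
  qed
qed

theorem theorem3p1:
  fixes X :: "'a set" and \<B> :: "'a set set" and v b r k :: nat
  assumes "symmetric_bibd X \<B> v b r k 1"
  shows "int (localization_number (incidence_verts X \<B>) (incidence_edges X \<B>)) > int k - 1"
proof -
  let ?V = "incidence_verts X \<B>" and ?E = "incidence_edges X \<B>"
  have D: "bibd X \<B> v v k k 1"
    using assms symmetric_bibd_replication[OF assms] by (auto simp: symmetric_bibd_def)
  have V: "?V = Inl ` X \<union> Inr ` \<B>"
    by (auto simp: incidence_verts_def)
  have fin: "finite X" "finite \<B>"
    using D bibd_finite_blocks[OF D] by (auto simp: bibd_def)
  have no_win: "\<not> cops_win ?V ?E m" if "m < k" for m
  \<comment> \<open>For \<open>k = 1\<close> there is only one point, so no pair on one side exists.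
    But then no cop probes, and a point and a block remain candidates forever by staying
    put.\<close>
  proof (cases "k = 1")
    case True
    then have m: "m = 0" using that by simp
    obtain x where x: "x \<in> X" using D by (auto simp: bibd_def)
    have "card \<B> = card X" "card X > 0"
      using D fin by (auto simp: bibd_def card_gt_0_iff)
    then obtain B where B: "B \<in> \<B>" by fastforce
    show ?thesis
    proof (rule not_cops_winI)
      show "{Inl x, Inr B} \<in> {{Inl x, Inr B}}" by simp
    qed (use m x B V in auto)
  next
    case False
    then have "k \<ge> 2" using that by simp
    then interpret plane_graph "Inl ` X" "Inr ` \<B>" ?E k
      using symmetric_bibd_plane_graph[OF assms] by simp
    \<comment> \<open>Counting flags at a point gives
      \<open>v - 1 = k * (k - 1) > 0\<close>.\<close>
    have "card X > 1"
      using bibd_flags_at_point[OF D] \<open>k \<ge> 2\<close> D by (cases "card X > 1") (auto simp: bibd_def)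
    then obtain x y where "x \<in> X" "y \<in> X" "x \<noteq> y"
      using card_le_Suc0_iff_eq[OF fin(1)] by fastforce
    then show ?thesis
      using not_cops_win_plane[OF that, of "Inl x" "Inl y"] V by auto
  qed
  \<comment> \<open>Probing all vertices wins, so \<open>LEAST\<close> is attained and is itself a
    winning number of cops.\<close>
  have "cops_win ?V ?E (localization_number ?V ?E)"
    unfolding localization_number_def
    by (rule LeastI[of "cops_win ?V ?E"], rule cops_win_card) (simp add: V fin)
  then have "\<not> localization_number ?V ?E < k"
    using no_win by blast
  then show ?thesis by linarith
qed

end
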